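(* Let $n\geqslant 4$, let $S$ be a square-free subset of $\mathbb{Z}_n$ with $n=p|S|$ for some prime $p$, and suppose the Cayley sum graph $\Gamma=\mathrm{CS}(\mathbb{Z}_n,S)$ is connected. Let $H=\{g\in\mathbb{Z}_n: S+g=S\}$ be the subgroup of periods of $S$, and put $k=|S|/|H|$. Then $\Gamma$ has a total perfect code if and only if $p=2$ and $s\not\equiv s'\pmod{k}$ for all $s,s'\in S$ with $H+s\neq H+s'$. In this case, the total perfect codes of $\Gamma$ have the general form $\{h_1+i,\ h_2+i+k\}$, where $h_1,h_2\in H$ and $0\leqslant i\leqslant k$.
   Context: For an abelian group $G$ and $S\subseteq G$, the Cayley sum graph $\mathrm{CS}(G,S)$ has vertex set $G$, two vertices $g,h$ being adjacent iff $g+h\in S$ and $g\neq h$. A total perfect code of a graph is a set $C$ of vertices such that every vertex has exactly one neighbor in $C$. An element $x\in G$ is a square if $x=y+y$ for some $y\in G$; $S$ is square-free if it contains no squares. For $X\subseteq G$ and a subgroup $H$, $X+g=\{x+g:x\in X\}$ and $X/H=\{H+x:x\in X\}$. Elements of $\mathbb{Z}_n$ are identified with integers $0,\dots,n-1$. *)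

theory Defs
  imports
    "HOL-Algebra.Elementary_Groups"
    "HOL-Number_Theory.Cong"
    "Graph_Theory.Digraph_Component"
begin

text \<open>
  Abelian groups are those of \<^emph>\<open>HOL-Algebra\<close>, so the group operation is written
  multiplicatively: \<open>g \<otimes> h\<close> is the sum of \<open>g\<close> and \<open>h\<close>, \<open>X #> g\<close> the translate \<open>X + g\<close>,
  and \<open>H #> x\<close> the coset \<open>H + x\<close>. The cyclic group of order \<open>n > 0\<close> is
  \<^term>\<open>integer_mod_group n\<close>, whose elements are the integers \<open>0, \<dots>, n - 1\<close>.
  As in \<^emph>\<open>Graph_Theory\<close>, an undirected graph is a symmetric digraph.
\<close>

definition cayley_sum_graph :: "('a, 'b) monoid_scheme \<Rightarrow> 'a set \<Rightarrow> 'a pair_pre_digraph" where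
  "cayley_sum_graph G S =
     \<lparr> pverts = carrier G,
       parcs = {(g, h). g \<in> carrier G \<and> h \<in> carrier G \<and> g \<otimes>\<^bsub>G\<^esub> h \<in> S \<and> g \<noteq> h} \<rparr>"

definition total_perfect_code :: "('a, 'b) pre_digraph \<Rightarrow> 'a set \<Rightarrow> bool" where
  "total_perfect_code \<Gamma> C \<longleftrightarrow>
     C \<subseteq> verts \<Gamma> \<and> (\<forall>v \<in> verts \<Gamma>. \<exists>!c. c \<in> C \<and> v \<rightarrow>\<^bsub>\<Gamma>\<^esub> c)"

definition is_group_square :: "('a, 'b) monoid_scheme \<Rightarrow> 'a \<Rightarrow> bool" where
  "is_group_square G x \<longleftrightarrow> (\<exists>y \<in> carrier G. x = y \<otimes>\<^bsub>G\<^esub> y)"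

definition square_free :: "('a, 'b) monoid_scheme \<Rightarrow> 'a set \<Rightarrow> bool" where
  "square_free G S \<longleftrightarrow> (\<forall>x \<in> S. \<not> is_group_square G x)"

definition periods :: "('a, 'b) monoid_scheme \<Rightarrow> 'a set \<Rightarrow> 'a set" where
  "periods G S = {g \<in> carrier G. S #>\<^bsub>G\<^esub> g = S}"

lemma graph_cayley_sum_graph:
  assumes "comm_group G" "finite (carrier G)"
  shows "graph (with_proj (cayley_sum_graph G S))"
proof -
  interpret comm_group G by fact
  have fin: "finite {(g, h). g \<in> carrier G \<and> h \<in> carrier G \<and> g \<otimes>\<^bsub>G\<^esub> h \<in> S \<and> g \<noteq> h}"
    by (rule finite_subset[of _ "carrier G \<times> carrier G"]) (use assms(2) in auto)
  show ?thesis
    by unfold_locales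
      (use assms(2) fin in
        \<open>auto simp: cayley_sum_graph_def symmetric_def sym_def m_comm arc_to_ends_def\<close>)
qed

lemma subgroup_periods:
  assumes "comm_group G" "S \<subseteq> carrier G"
  shows "subgroup (periods G S) G"
proof -
  interpret comm_group G by fact
  show ?thesis
  proof (rule subgroupI)
    show "periods G S \<subseteq> carrier G"
      by (auto simp: periods_def)
    have "\<one>\<^bsub>G\<^esub> \<in> periods G S"
      using assms(2) by (simp add: periods_def coset_mult_one)
    then show "periods G S \<noteq> {}" by blast
  next
    fix a assume a: "a \<in> periods G S"
    then have ac: "a \<in> carrier G" and aS: "S #>\<^bsub>G\<^esub> a = S"
      by (auto simp: periods_def)
    have "S #>\<^bsub>G\<^esub> inv\<^bsub>G\<^esub> a = (S #>\<^bsub>G\<^esub> a) #>\<^bsub>G\<^esub> inv\<^bsub>G\<^esub> a"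
      by (simp only: aS)
    also have "\<dots> = S"
      using coset_mult_assoc[OF assms(2) ac inv_closed[OF ac]] ac assms(2)
      by (simp add: coset_mult_one)
    finally show "inv\<^bsub>G\<^esub> a \<in> periods G S"
      using a by (simp add: periods_def)
  next
    fix a b assume "a \<in> periods G S" "b \<in> periods G S"
    then show "a \<otimes>\<^bsub>G\<^esub> b \<in> periods G S"
      using assms(2) by (auto simp: periods_def simp flip: coset_mult_assoc)
  qed
qed

text \<open>The quotient \<open>|S| / |H|\<close> is therefore exact, and may be written with \<open>div\<close>.\<close>

lemma card_periods_dvd:
  assumes "comm_group G" "finite (carrier G)" "S \<subseteq> carrier G"
  shows "card (periods G S) dvd card S"
proof -
  interpret comm_group G by fact
  let ?H = "periods G S"
  have sub: "subgroup ?H G" by (rule subgroup_periods) fact+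
  let ?P = "(\<lambda>s. ?H #>\<^bsub>G\<^esub> s) ` S"
  have P: "?P \<subseteq> rcosets\<^bsub>G\<^esub> ?H"
    using assms(3) by (auto simp: RCOSETS_def)
  have "\<Union> ?P = S"
  proof
    show "S \<subseteq> \<Union> ?P"
      using assms(3) sub by (auto intro: rcos_self)
    show "\<Union> ?P \<subseteq> S"
    proof
      fix x assume "x \<in> \<Union> ?P"
      then obtain h s where h: "h \<in> ?H" "s \<in> S" "x = h \<otimes>\<^bsub>G\<^esub> s"
        by (auto simp: r_coset_def)
      then have "x = s \<otimes>\<^bsub>G\<^esub> h"
        using assms(3) by (auto simp: periods_def m_comm)
      then have "x \<in> S #>\<^bsub>G\<^esub> h"
        using h by (auto simp: r_coset_def)
      then show "x \<in> S" using h by (simp add: periods_def)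
    qed
  qed
  moreover have "card ?H * card ?P = card (\<Union> ?P)"
  proof (rule card_partition)
    show "finite ?P" "finite (\<Union> ?P)"
      using finite_subset[OF assms(3,2)] \<open>\<Union> ?P = S\<close> by simp_all
    show "card c = card ?H" if "c \<in> ?P" for c
      using that P card_rcosets_equal[of c ?H] sub subgroup.subset by fastforce
    show "c1 \<inter> c2 = {}" if "c1 \<in> ?P" "c2 \<in> ?P" "c1 \<noteq> c2" for c1 c2
      using that P rcos_disjoint[OF sub] by (auto simp: pairwise_def disjnt_def)
  qed
  ultimately show ?thesis by (metis dvd_triv_left)
qed

end

theory Submission
  imports Defs
begin

text \<open>
  If \<open>n\<close> were odd, every element would be a square; so \<open>n\<close> is even, the squares are the even
  residues, and every element of \<open>S\<close> is odd. A vertex and its neighbours then have opposite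
  parities. If \<open>C\<close> is a total perfect code, the even vertices are partitioned by the neighbourhoods
  of the odd elements of \<open>C\<close>, each of size \<open>|S|\<close>. Hence \<open>n/2 = |S| \<cdot> |C\<^sub>o\<^sub>d\<^sub>d|\<close>, so \<open>p\<close> is even, i.e.
  \<open>p = 2\<close>. Conversely, \<open>p = 2\<close> forces \<open>S\<close> to be the set of all odd residues, so that \<open>\<Gamma>\<close> is complete
  bipartite, \<open>H\<close> is the set of even residues, \<open>k = 1\<close>, and the condition on \<open>S\<close> is vacuous.
\<close>

section \<open>Squares, parity and adjacency in the cyclic group\<close>

lemma carrier_integer_mod_group_pos:
  "n > 0 \<Longrightarrow> carrier (integer_mod_group n) = {0..<int n}"
  by (simp add: carrier_integer_mod_group)

lemma dominates_cayley_sum_graph: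
  "v \<rightarrow>\<^bsub>with_proj (cayley_sum_graph G S)\<^esub> c \<longleftrightarrow>
     v \<in> carrier G \<and> c \<in> carrier G \<and> v \<otimes>\<^bsub>G\<^esub> c \<in> S \<and> v \<noteq> c"
  by (simp add: cayley_sum_graph_def arcs_ends_def arc_to_ends_def)

text \<open>For odd \<open>n\<close>, one of \<open>x\<close> and \<open>x + n\<close> is even, so
  \<open>x\<close> can always be halved modulo \<open>n\<close>.\<close>

lemma square_integer_mod_group_odd:
  assumes "odd n" "x \<in> carrier (integer_mod_group n)"
  shows "is_group_square (integer_mod_group n) x"
proof -
  have n: "n > 0" using assms(1) by (simp add: odd_pos)
  have x: "0 \<le> x" "x < int n"
    using assms(2) n by (simp_all add: carrier_integer_mod_group_pos)
  define y where "y = (if even x then x div 2 else (x + int n) div 2)"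
  have "y \<in> {0..<int n}" "(y + y) mod int n = x"
    using x n assms(1) by (auto simp: y_def elim!: evenE oddE)
  then show ?thesis
    using n unfolding is_group_square_def
    by (intro bexI[of _ y]) (simp_all add: carrier_integer_mod_group_pos)
qed

lemma square_integer_mod_group_even:
  assumes "even x" "x \<in> carrier (integer_mod_group n)" "n > 0"
  shows "is_group_square (integer_mod_group n) x"
  using assms unfolding is_group_square_def
  by (intro bexI[of _ "x div 2"]) (auto simp: carrier_integer_mod_group_pos elim!: evenE)

text \<open>Makes parity a well-defined notion on residues, so that sums in the group can be tested
  before reduction.\<close>

lemma even_mod_even_iff:
  fixes x :: int
  assumes "even n"
  shows "even (x mod int n) \<longleftrightarrow> even x"
  using assms by (simp add: dvd_mod_iff)

lemma card_even_residues: "card {x. 0 \<le> x \<and> x < 2 * int m \<and> even x} = m"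
proof -
  have "{x. 0 \<le> x \<and> x < 2 * int m \<and> even x} = (\<lambda>y. 2 * y) ` {0..<int m}"
    by (auto elim!: evenE)
  then show ?thesis by (simp add: card_image inj_on_def)
qed

lemma card_odd_residues: "card {x. 0 \<le> x \<and> x < 2 * int m \<and> odd x} = m"
proof -
  have "{x. 0 \<le> x \<and> x < 2 * int m \<and> odd x} = (\<lambda>y. 2 * y + 1) ` {0..<int m}"
    by (auto elim!: oddE)
  then show ?thesis by (simp add: card_image inj_on_def)
qed

section \<open>Counting neighbourhoods of the odd code elements\<close>

lemma (in group) card_translate_vimage:
  assumes "S \<subseteq> carrier G" "c \<in> carrier G"
  shows "card {v \<in> carrier G. v \<otimes> c \<in> S} = card S"
proof -
  have "bij_betw (\<lambda>v. v \<otimes> c) {v \<in> carrier G. v \<otimes> c \<in> S} S"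
    using assms
    by (intro bij_betw_byWitness[where f' = "\<lambda>s. s \<otimes> inv c"]) (auto simp: m_assoc)
  then show ?thesis by (rule bij_betw_same_card)
qed

lemma card_odd_total_perfect_code:
  assumes "m > 0" "S \<subseteq> carrier Z" "\<forall>s \<in> S. odd s"
    and Z: "Z = integer_mod_group (2 * m)"
    and C: "total_perfect_code (with_proj (cayley_sum_graph Z S)) C"
  shows "card {c \<in> C. odd c} * card S = m"
proof -
  interpret group Z unfolding Z by simp
  let ?N = "\<lambda>c. {v \<in> carrier Z. v \<otimes>\<^bsub>Z\<^esub> c \<in> S}"
  let ?O = "{c \<in> C. odd c}" and ?E = "{x. 0 \<le> x \<and> x < 2 * int m \<and> even x}"
  have car: "carrier Z = {0..<2 * int m}"
    using \<open>m > 0\<close> by (simp add: Z carrier_integer_mod_group_pos)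
  have CZ: "C \<subseteq> carrier Z"
    using C by (simp add: total_perfect_code_def cayley_sum_graph_def)
  have ex1: "\<exists>!c. c \<in> C \<and> v \<otimes>\<^bsub>Z\<^esub> c \<in> S" if "v \<in> carrier Z" for v
  proof -
    \<comment> \<open>The inequality in the adjacency relation comes for free: \<open>v + v\<close>
      is even, also after reduction, while \<open>S\<close> contains only odd elements.\<close>
    have "v \<noteq> c" if "v \<otimes>\<^bsub>Z\<^esub> c \<in> S" for c
      using that assms(3) even_mod_even_iff[of "2 * m" "v + c"] by (auto simp: Z)
    moreover have "\<exists>!c. c \<in> C \<and> v \<in> carrier Z \<and> c \<in> carrier Z \<and> v \<otimes>\<^bsub>Z\<^esub> c \<in> S \<and> v \<noteq> c"
      using C that unfolding total_perfect_code_def dominates_cayley_sum_graph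
      by (simp add: cayley_sum_graph_def)
    ultimately show ?thesis
      using CZ that by (metis subsetD)
  qed
  have parity: "odd c \<longleftrightarrow> even v" if "v \<otimes>\<^bsub>Z\<^esub> c \<in> S" for v c
    using that assms(3) even_mod_even_iff[of "2 * m" "v + c"] by (auto simp: Z)
  \<comment> \<open>Existence of a code neighbour gives the covering here; its uniqueness gives the
    disjointness of the sets \<open>?N c\<close> below.\<close>
  have "?E = (\<Union>c \<in> ?O. ?N c)"
  proof (intro equalityI subsetI)
    fix v assume "v \<in> ?E"
    then show "v \<in> (\<Union>c \<in> ?O. ?N c)"
      using ex1[of v] parity[of v] by (auto simp: car)
  next
    fix v assume "v \<in> (\<Union>c \<in> ?O. ?N c)"
    then show "v \<in> ?E" using parity by (auto simp: car)
  qed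
  then have "m = card (\<Union>c \<in> ?O. ?N c)"
    using card_even_residues[of m] by simp
  also have "\<dots> = (\<Sum>c \<in> ?O. card (?N c))"
  proof (rule card_UN_disjoint)
    show "finite ?O" using CZ by (auto simp: car intro: finite_subset)
    show "\<forall>c \<in> ?O. finite (?N c)"
      by (auto simp: car intro: finite_subset[of _ "{0..<2 * int m}"])
    show "\<forall>c \<in> ?O. \<forall>d \<in> ?O. c \<noteq> d \<longrightarrow> ?N c \<inter> ?N d = {}"
      using ex1 by blast
  qed
  also have "\<dots> = card ?O * card S"
    using CZ by (simp add: card_translate_vimage[OF assms(2)] subset_iff)
  finally show ?thesis ..
qed

section \<open>The connection set of all odd residues\<close>

lemma periods_odd_residues:
  assumes "m > 0"
  shows "periods (integer_mod_group (2 * m)) {x. 0 \<le> x \<and> x < 2 * int m \<and> odd x} =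
    {x. 0 \<le> x \<and> x < 2 * int m \<and> even x}" (is "periods ?Z ?O = ?E")
proof (intro equalityI subsetI)
  fix g assume g: "g \<in> periods ?Z ?O"
  \<comment> \<open>Translating the single element 1 of \<open>?O\<close> already forces a period
    \<open>g\<close> to be even.\<close>
  have "(1 + g) mod (2 * int m) \<in> ?O #>\<^bsub>?Z\<^esub> g"
    using assms by (auto simp: r_coset_def intro!: exI[of _ 1])
  then have "odd ((1 + g) mod int (2 * m))"
    using g by (simp add: periods_def)
  then have "even g" unfolding even_mod_even_iff[OF dvd_triv_left] by simp
  then show "g \<in> ?E"
    using g assms by (simp add: periods_def carrier_integer_mod_group_pos)
next
  fix g assume g: "g \<in> ?E"
  have "?O #>\<^bsub>?Z\<^esub> g = ?O"
  proof (intro equalityI subsetI)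
    fix x assume "x \<in> ?O #>\<^bsub>?Z\<^esub> g"
    then obtain y where "y \<in> ?O" and x: "x = (y + g) mod (2 * int m)"
      by (auto simp: r_coset_def)
    then have "odd (y + g)" using g by simp
    then show "x \<in> ?O"
      using assms even_mod_even_iff[of "2 * m" "y + g"] by (simp add: x)
  next
    fix x assume x: "x \<in> ?O"
    have "(x - g) mod (2 * int m) \<in> ?O"
      using x g assms even_mod_even_iff[of "2 * m" "x - g"] by simp
    moreover have "((x - g) mod (2 * int m) + g) mod (2 * int m) = x"
      using x by (simp add: mod_simps)
    ultimately show "x \<in> ?O #>\<^bsub>?Z\<^esub> g"
      unfolding r_coset_def by force
  qed
  then show "g \<in> periods ?Z ?O"
    using g assms by (simp add: periods_def carrier_integer_mod_group_pos)
qed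

text \<open>Adjacency here means opposite parity, so the graph is complete bipartite, and a code
  must meet each of the two parts in exactly one vertex.\<close>

lemma total_perfect_code_odd_residues:
  assumes "m > 0"
    and Z: "Z = integer_mod_group (2 * m)"
    and S: "S = {x. 0 \<le> x \<and> x < 2 * int m \<and> odd x}"
  shows "total_perfect_code (with_proj (cayley_sum_graph Z S)) C \<longleftrightarrow>
    (\<exists>e o'. e \<in> carrier Z \<and> even e \<and> o' \<in> carrier Z \<and> odd o' \<and> C = {e, o'})"
    (is "?L \<longleftrightarrow> ?R")
proof -
  have car: "carrier Z = {0..<2 * int m}"
    using \<open>m > 0\<close> by (simp add: Z carrier_integer_mod_group_pos)
  have "v \<otimes>\<^bsub>Z\<^esub> c \<in> S \<longleftrightarrow> odd (v + c)" for v c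
    using even_mod_even_iff[of "2 * m" "v + c"] \<open>m > 0\<close> by (simp add: Z S)
  then have dom: "v \<rightarrow>\<^bsub>with_proj (cayley_sum_graph Z S)\<^esub> c \<longleftrightarrow>
      v \<in> carrier Z \<and> c \<in> carrier Z \<and> odd (v + c)" for v c
    unfolding dominates_cayley_sum_graph by (cases "v = c") simp_all
  have verts: "verts (with_proj (cayley_sum_graph Z S)) = carrier Z"
    by (simp add: cayley_sum_graph_def)
  have tpc: "?L \<longleftrightarrow> C \<subseteq> carrier Z \<and> (\<forall>v \<in> carrier Z. \<exists>!c. c \<in> C \<and> odd (v + c))"
    unfolding total_perfect_code_def dom verts
    \<comment> \<open>\<open>conj_cong\<close> provides \<open>C \<subseteq> carrier Z\<close> while
      the second conjunct is rewritten, which absorbs the carrier conditions of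
      \<open>dom\<close>.\<close>
    by (intro conj_cong refl ball_cong arg_cong[where f = Ex1] ext) blast
  show ?thesis
  proof
    assume L: ?L
    \<comment> \<open>The vertices 0 and 1 stand for the two parts: the code neighbours of 0 are the
      odd elements of \<open>C\<close>, those of 1 the even ones.\<close>
    have "0 \<in> carrier Z" "1 \<in> carrier Z"
      using \<open>m > 0\<close> by (auto simp: car)
    then have "\<exists>!c. c \<in> C \<and> odd (0 + c)" "\<exists>!c. c \<in> C \<and> odd (1 + c)"
      using L tpc by blast+
    then obtain o' e where mem: "o' \<in> C \<and> odd (0 + o')" "e \<in> C \<and> odd (1 + e)"
      and uniq: "\<And>c. c \<in> C \<and> odd (0 + c) \<Longrightarrow> c = o'" "\<And>c. c \<in> C \<and> odd (1 + c) \<Longrightarrow> c = e"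
      by (elim ex1E) blast
    have eo: "o' \<in> C" "odd o'" "e \<in> C" "even e" using mem by simp_all
    have "c = e \<or> c = o'" if "c \<in> C" for c
      using uniq[of c] that by (cases "even c") simp_all
    then have "C = {e, o'}" using eo by blast
    moreover have "C \<subseteq> carrier Z" using L tpc by blast
    ultimately show ?R using eo by (intro exI[of _ e] exI[of _ o']) simp
  next
    assume ?R
    then obtain e o' where "e \<in> carrier Z" "even e" "o' \<in> carrier Z" "odd o'" "C = {e, o'}"
      by blast
    moreover from this have "\<exists>!c. c \<in> C \<and> odd (v + c)" for v
      by (cases "even v") auto
    ultimately show ?L using tpc by simp
  qed
qed

theorem theorem3p4:
  fixes n p k :: nat
    and S H :: "int set"
    and Z :: "int monoid"
    and \<Gamma> :: "(int, int \<times> int) pre_digraph"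
  assumes "n \<ge> 4"
    and Z: "Z = integer_mod_group n"
    and "S \<subseteq> carrier Z"
    and "square_free Z S"
    and "prime p"
    and "n = p * card S"
    and \<Gamma>: "\<Gamma> = with_proj (cayley_sum_graph Z S)"
    and "Digraph_Component.connected \<Gamma>"
    and H: "H = periods Z S"
    and k: "k = card S div card H"
  shows "((\<exists>C. total_perfect_code \<Gamma> C) \<longleftrightarrow>
            p = 2 \<and>
            (\<forall>s \<in> S. \<forall>s' \<in> S. H #>\<^bsub>Z\<^esub> s \<noteq> H #>\<^bsub>Z\<^esub> s' \<longrightarrow> \<not> [s = s'] (mod int k)))
       \<and> ((\<exists>C. total_perfect_code \<Gamma> C) \<longrightarrow>
            (\<forall>C. total_perfect_code \<Gamma> C \<longleftrightarrow>
               (\<exists>h\<^sub>1 \<in> H. \<exists>h\<^sub>2 \<in> H. \<exists>i::nat. i \<le> k \<and>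
                  C = {h\<^sub>1 \<otimes>\<^bsub>Z\<^esub> int i, h\<^sub>2 \<otimes>\<^bsub>Z\<^esub> int i \<otimes>\<^bsub>Z\<^esub> int k})))"
proof -
  have cS: "card S > 0" using \<open>n \<ge> 4\<close> \<open>n = p * card S\<close> by (cases "card S") auto
  then obtain s0 where s0: "s0 \<in> S" by fastforce
  have "even n"
    using square_integer_mod_group_odd[of n s0] s0 \<open>S \<subseteq> carrier Z\<close> \<open>square_free Z S\<close>
    by (auto simp: square_free_def Z)
  then obtain m where n: "n = 2 * m" by blast
  have m: "m > 0" "m \<ge> 2" using \<open>n \<ge> 4\<close> n by auto
  have car: "carrier Z = {0..<2 * int m}"
    using m by (simp add: Z n carrier_integer_mod_group_pos)
  have oddS: "\<forall>s \<in> S. odd s"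
    using square_integer_mod_group_even[of _ n] \<open>S \<subseteq> carrier Z\<close> \<open>square_free Z S\<close> n m
    by (auto simp: square_free_def Z)
  have p2: "p = 2" if "total_perfect_code \<Gamma> C" for C
  proof -
    have "card {c \<in> C. odd c} * card S = m"
      using card_odd_total_perfect_code[OF m(1) \<open>S \<subseteq> carrier Z\<close> oddS Z[unfolded n]] that
      by (simp add: \<Gamma>)
    \<comment> \<open>Both sides equal \<open>n = 2 * m\<close>; cancelling
      \<open>card S > 0\<close> shows that the prime \<open>p\<close> is even.\<close>
    then have "p * card S = (2 * card {c \<in> C. odd c}) * card S"
      using \<open>n = p * card S\<close> n by (metis mult.assoc)
    then have "p = 2 * card {c \<in> C. odd c}"
      unfolding mult_cancel2 using cS by simp
    then have "even p" by simp
    then show "p = 2" using \<open>prime p\<close> primes_dvd_imp_eq two_is_prime_nat by blast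
  qed
  show ?thesis
  proof (cases "p = 2")
    \<comment> \<open>Without a code, both sides of the equivalence fail and the description of the
      codes holds vacuously.\<close>
    case False
    then show ?thesis using p2 by blast
  next
    case True
    \<comment> \<open>\<open>S\<close> consists of odd residues, and for \<open>p = 2\<close> it has
      \<open>m\<close> elements, as many as there are odd residues.\<close>
    have S: "S = {x. 0 \<le> x \<and> x < 2 * int m \<and> odd x}"
    proof (rule card_subset_eq)
      show "S \<subseteq> {x. 0 \<le> x \<and> x < 2 * int m \<and> odd x}"
        using oddS \<open>S \<subseteq> carrier Z\<close> by (simp add: car subset_iff)
      show "finite {x. 0 \<le> x \<and> x < 2 * int m \<and> odd x}"
        by (rule finite_subset[of _ "{0..<2 * int m}"]) auto
      show "card S = card {x. 0 \<le> x \<and> x < 2 * int m \<and> odd x}"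
        using \<open>n = p * card S\<close> n True by (simp add: card_odd_residues)
    qed
    have H': "H = {x. 0 \<le> x \<and> x < 2 * int m \<and> even x}"
      unfolding H S Z n by (rule periods_odd_residues[OF m(1)])
    have k1: "k = 1"
      using m by (simp add: k H' S card_even_residues card_odd_residues)
    have mult: "x \<otimes>\<^bsub>Z\<^esub> y = (x + y) mod (2 * int m)" for x y by (simp add: Z n)
    note tpc = total_perfect_code_odd_residues[OF m(1) Z[unfolded n] S, folded \<Gamma>]
    have "\<exists>C. total_perfect_code \<Gamma> C"
    proof -
      have "0 \<in> carrier Z" "1 \<in> carrier Z" using m by (auto simp: car)
      then show ?thesis unfolding tpc by (metis even_zero odd_one)
    qed
    \<comment> \<open>\<open>S\<close> is a single coset of the even residues, so the congruence
      condition has no pair to exclude.\<close>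
    moreover have "H #>\<^bsub>Z\<^esub> s = H #>\<^bsub>Z\<^esub> s'" if "s \<in> S" "s' \<in> S" for s s'
    proof -
      have "H #>\<^bsub>Z\<^esub> s = S" if "s \<in> S" for s
      proof (intro equalityI subsetI)
        fix x assume "x \<in> H #>\<^bsub>Z\<^esub> s"
        then obtain h where "h \<in> H" and x: "x = (h + s) mod (2 * int m)"
          unfolding r_coset_def mult by blast
        then have "odd (h + s)" using that by (simp add: H' S)
        then show "x \<in> S"
          using m even_mod_even_iff[of "2 * m" "h + s"] by (simp add: S x)
      next
        fix x assume x: "x \<in> S"
        have "(x - s) mod (2 * int m) \<in> H"
          using x that m even_mod_even_iff[of "2 * m" "x - s"] by (simp add: H' S)
        moreover have "((x - s) mod (2 * int m) + s) mod (2 * int m) = x"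
          using x by (simp add: mod_simps S)
        ultimately show "x \<in> H #>\<^bsub>Z\<^esub> s"
          unfolding r_coset_def mult by force
      qed
      then show ?thesis using that by simp
    qed
    moreover have "total_perfect_code \<Gamma> C \<longleftrightarrow>
               (\<exists>h\<^sub>1 \<in> H. \<exists>h\<^sub>2 \<in> H. \<exists>i::nat. i \<le> k \<and>
                  C = {h\<^sub>1 \<otimes>\<^bsub>Z\<^esub> int i, h\<^sub>2 \<otimes>\<^bsub>Z\<^esub> int i \<otimes>\<^bsub>Z\<^esub> int k})" (is "_ \<longleftrightarrow> ?R") for C
    proof
      assume "total_perfect_code \<Gamma> C"
      then obtain e o' where eo: "e \<in> carrier Z" "even e" "o' \<in> carrier Z" "odd o'" "C = {e, o'}"
        unfolding tpc by blast
      have "e \<in> H" using eo by (auto simp: H' car)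
      moreover have "o' - 1 \<in> H" using eo by (auto simp: H' car elim!: oddE)
      \<comment> \<open>Since \<open>k = 1\<close>, the choice \<open>i = 0\<close> reaches every
        code; \<open>o' - 1\<close> is an even residue because \<open>o'\<close> is odd and hence at
        least 1.\<close>
      moreover have "C = {e \<otimes>\<^bsub>Z\<^esub> int 0, (o' - 1) \<otimes>\<^bsub>Z\<^esub> int 0 \<otimes>\<^bsub>Z\<^esub> int k}"
        using eo by (simp add: mult k1 car mod_simps)
      ultimately show ?R by blast
    next
      assume ?R
      then obtain h\<^sub>1 h\<^sub>2 i where h: "h\<^sub>1 \<in> H" "h\<^sub>2 \<in> H"
        and C: "C = {h\<^sub>1 \<otimes>\<^bsub>Z\<^esub> int i, h\<^sub>2 \<otimes>\<^bsub>Z\<^esub> int i \<otimes>\<^bsub>Z\<^esub> int k}" by blast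
      have closed: "x \<otimes>\<^bsub>Z\<^esub> y \<in> carrier Z" for x y using m by (simp add: mult car)
      have parity: "even (x \<otimes>\<^bsub>Z\<^esub> y) \<longleftrightarrow> even (x + y)" for x y
        using even_mod_even_iff[of "2 * m" "x + y"] by (simp add: mult)
      have "even h\<^sub>1" "even h\<^sub>2" using h by (auto simp: H')
      let ?a = "h\<^sub>1 \<otimes>\<^bsub>Z\<^esub> int i" and ?b = "h\<^sub>2 \<otimes>\<^bsub>Z\<^esub> int i \<otimes>\<^bsub>Z\<^esub> int k"
      \<comment> \<open>The shift by \<open>k = 1\<close> separates the parities for every
        \<open>i\<close>. An odd \<open>i\<close> makes \<open>?a\<close> the odd element, so the
        case split below exchanges the roles of \<open>?a\<close> and \<open>?b\<close>.\<close>
      have opposite: "even ?b \<longleftrightarrow> odd ?a"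
        using \<open>even h\<^sub>1\<close> \<open>even h\<^sub>2\<close> by (simp add: parity k1)
      show "total_perfect_code \<Gamma> C"
      proof (cases "even ?a")
        case True
        then show ?thesis
          unfolding tpc C using closed opposite by blast
      next
        case False
        then show ?thesis
          unfolding tpc C insert_commute[of ?a ?b] using closed opposite by blast
      qed
    qed
    ultimately show ?thesis using True by blast
  qed
qed

end
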